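(* Let $G_0$ be a finite abelian group, and for integers $a,b$ write $[[a]]\coloneqq\{a\}\times G_0$ and $[[a,b]]\coloneqq\{n\in\mathbb{Z}:a\le n\le b\}\times G_0$, subsets of $\mathbb{Z}\times G_0$. Let $A^{(0)},A^{(1)}\subset\mathbb{Z}\times G_0$ be such that there is $n_0$ with $A^{(0)}\cap[[n]]=A^{(1)}\cap[[n]]$ for all $n\le -n_0$. Suppose there is a finite subset $F$ of $\mathbb{Z}\times G_0$ with $A^{(0)}\oplus F=A^{(1)}\oplus F$. Then for every function $\omega\colon\mathbb{Z}\to\{0,1\}$, the set $A^{(\omega)}\coloneqq\bigcup_{n\in\mathbb{Z}}A^{(\omega(n))}\cap[[n]]$ satisfies $A^{(\omega)}\oplus F=A^{(0)}\oplus F$.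
   Context: For subsets $A,F$ of an abelian group, $A\oplus F$ denotes $\{a+f:a\in A,f\in F\}$ if all these sums are distinct, and is undefined otherwise; an equation is regarded as false if any of its terms is undefined (so the hypothesis includes that $A^{(0)}\oplus F$ and $A^{(1)}\oplus F$ are defined, and the conclusion includes that $A^{(\omega)}\oplus F$ is defined). *)

theory Defs
  imports "HOL-Library.Product_Plus"
begin

text \<open>
  The finite abelian group \<open>G\<^sub>0\<close> is a type \<open>'g :: {finite, ab_group_add}\<close>; the group
  \<open>\<int> \<times> G\<^sub>0\<close> is the product type \<open>int \<times> 'g\<close> with componentwise addition.
\<close>

definition slice :: "int \<Rightarrow> (int \<times> 'g) set"
  where "slice a = {a} \<times> UNIV"

text \<open>The partial operation \<open>A \<oplus> F\<close>; \<^term>\<open>None\<close> represents ``undefined''.\<close>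

definition direct_sum :: "'a::ab_group_add set \<Rightarrow> 'a set \<Rightarrow> 'a set option"
  where "direct_sum A F =
    (if inj_on (\<lambda>(a, f). a + f) (A \<times> F) then Some {a + f |a f. a \<in> A \<and> f \<in> F} else None)"

text \<open>
  Equality of possibly undefined terms, false as soon as a side is undefined
  (plain HOL equality would make two undefined terms equal).
\<close>

definition defined_eq :: "'b option \<Rightarrow> 'b option \<Rightarrow> bool"  (infix \<open>\<doteq>\<close> 50)
  where "X \<doteq> Y \<longleftrightarrow> X \<noteq> None \<and> Y \<noteq> None \<and> X = Y"

text \<open>Only the members \<open>A 0\<close> and \<open>A 1\<close> of the family matter when \<open>\<omega>\<close> takes values in \<open>{0, 1}\<close>.\<close>

definition mixed :: "(nat \<Rightarrow> (int \<times> 'g) set) \<Rightarrow> (int \<Rightarrow> nat) \<Rightarrow> (int \<times> 'g) set"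
  where "mixed A \<omega> = (\<Union>n. A (\<omega> n) \<inter> slice n)"

end

theory Submission
  imports Defs "HOL-Library.Poly_Mapping"
begin

text \<open>
  Write \<open>D\<^sub>n\<close> and \<open>F\<^sub>m\<close> for the elements of the group ring \<open>\<int>[G\<^sub>0]\<close> given by the \<open>n\<close>-th slice of
  \<open>1\<^bsub>A 1\<^esub> - 1\<^bsub>A 0\<^esub>\<close> and the \<open>m\<close>-th slice of \<open>1\<^bsub>F\<^esub>\<close>. The hypothesis says that the Laurent series
  \<open>\<Sum>\<^sub>n D\<^sub>n T\<^sup>n\<close> is annihilated by the Laurent polynomial \<open>\<Sum>\<^sub>m F\<^sub>m T\<^sup>m\<close>. Since \<open>\<int>[G\<^sub>0]\<close> is
  commutative and reduced, this forces \<open>D\<^sub>n F\<^sub>m = 0\<close> for all \<open>n\<close> and \<open>m\<close>, so the slices of \<open>A 0\<close>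
  and \<open>A 1\<close> can be exchanged independently of one another.
\<close>

text \<open>
  Multiplying the coefficient equation of index \<open>i + j\<close> by \<open>D i * F j\<close> kills every term but the
  square of \<open>D i * F j\<close>, since any other term acquires a factor \<open>D i' * F j'\<close> of smaller index.
\<close>

lemma reduced_laurent_mult_eq_0:
  fixes D F :: "int \<Rightarrow> 'r::comm_ring"
  assumes reduced: "\<And>x::'r. x * x = 0 \<Longrightarrow> x = 0"
    and "finite J"
    and D: "\<And>n. n \<le> N \<Longrightarrow> D n = 0"
    and conv: "\<And>k. (\<Sum>j\<in>J. D (k - j) * F j) = 0"
    and "j \<in> J"
  shows "D i * F j = 0"
proof -
  obtain m where m: "\<And>j. j \<in> J \<Longrightarrow> m \<le> j"
    using \<open>finite J\<close> by (meson Min_le)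
  show ?thesis
    using \<open>j \<in> J\<close>
  \<comment> \<open>Truncation by \<open>nat\<close> puts every pair with
    \<open>i + j \<le> N + m\<close> at the bottom. There \<open>m \<le> j\<close> forces
    \<open>i \<le> N\<close>, so \<open>D i\<close> already vanishes.\<close>
  proof (induction "nat (i + j - (N + m))" arbitrary: i j rule: less_induct)
    case less
    show ?case
    proof (cases "i + j \<le> N + m")
      case True
      then have "i \<le> N"
        using m[OF less.prems] by linarith
      then show ?thesis
        by (simp add: D)
    next
      case False
      have IH: "D i' * F j' = 0" if "i' + j' < i + j" "j' \<in> J" for i' j'
        using less.hyps[of i' j'] that False by simp
      have "D i * F j * (D (i + j - j') * F j') = 0" if "j' \<in> J" "j' \<noteq> j" for j'
      \<comment> \<open>Swapping the partners of \<open>D i\<close> and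
        \<open>D (i + j - j')\<close> gives index sums \<open>i + j'\<close> and
        \<open>i + 2 j - j'\<close>; since \<open>j' \<noteq> j\<close>, exactly one of them lies
        below \<open>i + j\<close>.\<close>
      proof (cases "j' < j")
        case True
        then have "D i * F j' = 0"
          by (intro IH) (use that in auto)
        then show ?thesis
          by (metis mult.assoc mult.commute mult_zero_left)
      next
        case False
        then have "D (i + j - j') * F j = 0"
          by (intro IH) (use that less.prems in auto)
        then show ?thesis
          by (metis mult.assoc mult.commute mult_zero_left)
      qed
      then have "(\<Sum>j'\<in>J. D i * F j * (D (i + j - j') * F j')) =
          (\<Sum>j'\<in>{j}. D i * F j * (D (i + j - j') * F j'))"
        using \<open>finite J\<close> less.prems by (intro sum.mono_neutral_right) auto
      moreover have "(\<Sum>j'\<in>J. D i * F j * (D (i + j - j') * F j')) = 0"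
        using conv[of "i + j"] by (simp flip: sum_distrib_left)
      ultimately have "D i * F j * (D i * F j) = 0"
        by simp
      then show ?thesis
        by (rule reduced)
    qed
  qed
qed

lemma lookup_times_finite:
  fixes p q :: "'g::{finite, ab_group_add} \<Rightarrow>\<^sub>0 'r::semiring_0"
  shows "Poly_Mapping.lookup (p * q) x =
    (\<Sum>y\<in>UNIV. Poly_Mapping.lookup p (x - y) * Poly_Mapping.lookup q y)"
proof -
  have "x = l + y \<longleftrightarrow> y = x - l" for l y :: 'g
    by (auto simp: algebra_simps)
  then have "Poly_Mapping.lookup (p * q) x =
      (\<Sum>l\<in>UNIV. Poly_Mapping.lookup p l * Poly_Mapping.lookup q (x - l))"
    by (simp add: times_poly_mapping.rep_eq prod_fun_def Sum_any.expand_superset[of UNIV])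
  also have "\<dots> = (\<Sum>y\<in>UNIV. Poly_Mapping.lookup p (x - y) * Poly_Mapping.lookup q y)"
    by (rule sum.reindex_bij_witness[of _ "\<lambda>y. x - y" "\<lambda>y. x - y"]) auto
  finally show ?thesis .
qed

lemma lookup_Abs_finite [simp]:
  "Poly_Mapping.lookup (Abs_poly_mapping f) = (f :: 'g::finite \<Rightarrow> 'r::zero)"
  by (simp add: Abs_poly_mapping_inverse)

text \<open>
  With \<open>f\<^sup>*(x) = f(-x)\<close>, the element \<open>h = f f\<^sup>*\<close> is self-adjoint, and the coefficients of \<open>h h\<close> and
  of \<open>f f\<^sup>*\<close> at \<open>0\<close> are sums of squares.
\<close>

lemma group_ring_reduced:
  fixes f :: "'g::{finite, ab_group_add} \<Rightarrow>\<^sub>0 'r::linordered_idom"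
  assumes "f * f = 0"
  shows "f = 0"
proof -
  define adj :: "('g \<Rightarrow>\<^sub>0 'r) \<Rightarrow> ('g \<Rightarrow>\<^sub>0 'r)"
    where "adj p = Abs_poly_mapping (\<lambda>x. Poly_Mapping.lookup p (- x))" for p
  have adj [simp]: "Poly_Mapping.lookup (adj p) x = Poly_Mapping.lookup p (- x)" for p x
    by (simp add: adj_def)
  have adj_eq_0: "p = 0" if "p * adj p = 0" for p
  proof -
    have "(\<Sum>y\<in>UNIV. Poly_Mapping.lookup p (- y) * Poly_Mapping.lookup p (- y)) = 0"
      using lookup_times_finite[of p "adj p" 0] that by simp
    then have "Poly_Mapping.lookup p (- y) = 0" for y
      by (subst (asm) sum_nonneg_eq_0_iff) auto
    then have "Poly_Mapping.lookup p y = 0" for y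
      by (metis minus_minus)
    then show ?thesis
      by (simp add: poly_mapping_eqI)
  qed
  define h where "h = f * adj f"
  have "adj h = h"
  proof (rule poly_mapping_eqI)
    fix x
    have "Poly_Mapping.lookup (adj h) x =
        (\<Sum>y\<in>UNIV. Poly_Mapping.lookup f (- x - y) * Poly_Mapping.lookup f (- y))"
      by (simp add: h_def lookup_times_finite)
    also have "\<dots> = (\<Sum>y\<in>UNIV. Poly_Mapping.lookup f (x - y) * Poly_Mapping.lookup f (- y))"
      \<comment> \<open>The translation of \<open>y\<close> to \<open>x + y\<close> interchanges the
        two factors.\<close>
      by (rule sum.reindex_bij_witness[of _ "\<lambda>y. y - x" "\<lambda>y. x + y"])
        (auto simp: algebra_simps minus_diff_commute)
    finally show "Poly_Mapping.lookup (adj h) x = Poly_Mapping.lookup h x"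
      by (simp add: h_def lookup_times_finite)
  qed
  moreover have "h * h = f * f * (adj f * adj f)"
    by (simp add: h_def algebra_simps)
  \<comment> \<open>Self-adjointness turns \<open>h * h = 0\<close> into a case of
    \<open>adj_eq_0\<close>, which gives \<open>h = 0\<close>; as \<open>h\<close> is
    \<open>f * adj f\<close>, the same fact applies once more, to \<open>f\<close>.\<close>
  ultimately have "h * adj h = 0"
    using assms by simp
  then have "f * adj f = 0"
    unfolding h_def by (rule adj_eq_0)
  then show ?thesis
    by (rule adj_eq_0)
qed

text \<open>The left-hand sum counts the representations of \<open>z\<close> as
  \<open>a + f\<close>, since \<open>f\<close> determines \<open>a\<close>. Definedness means that
  no count exceeds 1, so definedness and value together become equations linear in the indicator of
  \<open>A\<close>.\<close>

lemma direct_sum_eq_Some_iff: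
  fixes A F S :: "'a::ab_group_add set"
  assumes "finite F"
  shows "direct_sum A F = Some S \<longleftrightarrow>
    (\<forall>z. (\<Sum>f\<in>F. of_bool (z - f \<in> A)) = (of_bool (z \<in> S) :: int))"
proof -
  define R where "R z = {f \<in> F. z - f \<in> A}" for z
  have [simp]: "finite (R z)" for z
    using assms by (simp add: R_def)
  have card_R: "(\<Sum>f\<in>F. of_bool (z - f \<in> A)) = int (card (R z))" for z
    using assms by (simp add: R_def Int_def conj_commute)
  have mem_R: "a \<in> A \<and> f \<in> F \<longleftrightarrow> f \<in> R (a + f)" for a f
    by (auto simp: R_def)
  have sums: "z \<in> {a + f |a f. a \<in> A \<and> f \<in> F} \<longleftrightarrow> R z \<noteq> {}" for z
  proof -
    have "z = a + f \<longleftrightarrow> a = z - f" for a f :: 'a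
      by (auto simp: algebra_simps)
    then show ?thesis
      by (auto simp: R_def)
  qed
  have inj: "inj_on (\<lambda>(a, f). a + f) (A \<times> F) \<longleftrightarrow> (\<forall>z. card (R z) \<le> 1)"
  proof
    assume inj: "inj_on (\<lambda>(a, f). a + f) (A \<times> F)"
    have "f = f'" if "f \<in> R z" "f' \<in> R z" for z f f'
      using inj_onD[OF inj, of "(z - f, f)" "(z - f', f')"] that by (auto simp: R_def)
    then show "\<forall>z. card (R z) \<le> 1"
      by (auto simp: card_le_Suc0_iff_eq)
  next
    assume "\<forall>z. card (R z) \<le> 1"
    then have R: "f = f'" if "f \<in> R z" "f' \<in> R z" for z f f'
      using that by (auto simp: card_le_Suc0_iff_eq)
    show "inj_on (\<lambda>(a, f). a + f) (A \<times> F)"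
    proof (rule inj_onI, clarsimp)
      fix a f a' f'
      assume "a \<in> A" "f \<in> F" "a' \<in> A" "f' \<in> F" and eq: "a + f = a' + f'"
      then have "f = f'"
        using R mem_R by metis
      with eq show "a = a' \<and> f = f'"
        by simp
    qed
  qed
  have pointwise: "card (R z) \<le> 1 \<and> (z \<in> S \<longleftrightarrow> R z \<noteq> {}) \<longleftrightarrow> int (card (R z)) = of_bool (z \<in> S)" for z
  proof -
    have "R z = {} \<longleftrightarrow> card (R z) = 0"
      by simp
    then show ?thesis
      by (cases "z \<in> S") (auto simp: le_Suc_eq)
  qed
  have "direct_sum A F = Some S \<longleftrightarrow> (\<forall>z. card (R z) \<le> 1) \<and> S = {a + f |a f. a \<in> A \<and> f \<in> F}"
    unfolding direct_sum_def inj by auto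
  also have "\<dots> \<longleftrightarrow> (\<forall>z. card (R z) \<le> 1 \<and> (z \<in> S \<longleftrightarrow> R z \<noteq> {}))"
    unfolding set_eq_iff[of S] sums by (rule all_conj_distrib[symmetric])
  finally show ?thesis
    unfolding pointwise card_R .
qed

text \<open>Grouping the elements of \<open>F\<close> by first coordinate, and padding each group to
  all of \<open>'g\<close> with zeros, makes each inner sum a convolution over \<open>'g\<close>,
  that is, a coefficient of a product in the group ring.\<close>

lemma sum_conv_slices:
  fixes F :: "(int \<times> 'g::{finite, ab_group_add}) set" and \<phi> :: "int \<times> 'g \<Rightarrow> int"
  assumes "finite F"
  shows "(\<Sum>f\<in>F. \<phi> ((k, g) - f)) =
    (\<Sum>j\<in>fst ` F. Poly_Mapping.lookup (Abs_poly_mapping (\<lambda>x. \<phi> (k - j, x)) *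
      Abs_poly_mapping (\<lambda>x. of_bool ((j, x) \<in> F))) g)"
proof -
  have "(\<Sum>f\<in>F. \<phi> ((k, g) - f)) =
      (\<Sum>f\<in>fst ` F \<times> UNIV. \<phi> ((k, g) - f) * of_bool (f \<in> F))"
    using assms by (intro sum.mono_neutral_cong_left) (auto intro: rev_image_eqI)
  also have "\<dots> = (\<Sum>j\<in>fst ` F. \<Sum>x\<in>UNIV. \<phi> (k - j, g - x) * of_bool ((j, x) \<in> F))"
    unfolding sum.cartesian_product by (intro sum.cong) auto
  finally show ?thesis
    by (simp add: lookup_times_finite)
qed

theorem theorem10p1:
  fixes A :: "nat \<Rightarrow> (int \<times> 'g::{finite, ab_group_add}) set"
    and F :: "(int \<times> 'g) set"
    and \<omega> :: "int \<Rightarrow> nat"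
  assumes "\<exists>n\<^sub>0::int. \<forall>n \<le> - n\<^sub>0. A 0 \<inter> slice n = A 1 \<inter> slice n"
    and "finite F"
    and "direct_sum (A 0) F \<doteq> direct_sum (A 1) F"
    and "range \<omega> \<subseteq> {0, 1}"
  shows "direct_sum (mixed A \<omega>) F \<doteq> direct_sum (A 0) F"
proof -
  obtain S where "direct_sum (A 0) F = Some S" "direct_sum (A 1) F = Some S"
    using assms(3) by (auto simp: defined_eq_def)
  then have S: "(\<Sum>f\<in>F. of_bool (z - f \<in> A 0)) = (of_bool (z \<in> S) :: int)"
    "(\<Sum>f\<in>F. of_bool (z - f \<in> A 1)) = (of_bool (z \<in> S) :: int)" for z
    using direct_sum_eq_Some_iff[OF \<open>finite F\<close>] by blast+
  define d :: "int \<times> 'g \<Rightarrow> int" where "d z = of_bool (z \<in> A 1) - of_bool (z \<in> A 0)" for z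
  define D where "D n = Abs_poly_mapping (\<lambda>x. d (n, x))" for n
  define P :: "int \<Rightarrow> 'g \<Rightarrow>\<^sub>0 int"
    where "P j = Abs_poly_mapping (\<lambda>x. of_bool ((j, x) \<in> F))" for j
  obtain n\<^sub>0 where n\<^sub>0: "\<And>n. n \<le> - n\<^sub>0 \<Longrightarrow> A 0 \<inter> slice n = A 1 \<inter> slice n"
    using assms(1) by blast
  have D_eq_0: "D n = 0" if "n \<le> - n\<^sub>0" for n
  proof (rule poly_mapping_eqI)
    fix x
    have "(n, x) \<in> A 0 \<longleftrightarrow> (n, x) \<in> A 1"
      using n\<^sub>0[OF that] by (auto simp: slice_def set_eq_iff)
    then show "Poly_Mapping.lookup (D n) x = Poly_Mapping.lookup 0 x"
      by (simp add: D_def d_def)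
  qed
  have conv: "(\<Sum>j\<in>fst ` F. D (k - j) * P j) = 0" for k
  proof (rule poly_mapping_eqI)
    fix g
    have "Poly_Mapping.lookup (\<Sum>j\<in>fst ` F. D (k - j) * P j) g = (\<Sum>f\<in>F. d ((k, g) - f))"
      unfolding sum_conv_slices[OF \<open>finite F\<close>] by (simp add: lookup_sum D_def P_def)
    also have "\<dots> = 0"
      by (simp add: d_def sum_subtractf S del: One_nat_def)
    finally show "Poly_Mapping.lookup (\<Sum>j\<in>fst ` F. D (k - j) * P j) g = Poly_Mapping.lookup 0 g"
      by simp
  qed
  have DP: "D n * P j = 0" if "j \<in> fst ` F" for n j
    using reduced_laurent_mult_eq_0[OF group_ring_reduced _ D_eq_0 conv that] \<open>finite F\<close> by blast
  \<comment> \<open>\<open>w\<close> is the correction that leads from the indicator of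
    \<open>A 0\<close> to that of \<open>mixed A \<omega>\<close>; each of its slices is a whole
    slice of \<open>d\<close> or zero.\<close>
  define w where "w z = of_bool (\<omega> (fst z) = 1) * d z" for z
  have mixed: "of_bool (z \<in> mixed A \<omega>) = of_bool (z \<in> A 0) + w z" for z
  proof -
    have "z \<in> mixed A \<omega> \<longleftrightarrow> z \<in> A (\<omega> (fst z))"
      by (cases z) (auto simp: mixed_def slice_def)
    moreover have "\<omega> (fst z) \<in> {0, 1}"
      using assms(4) by blast
    ultimately show ?thesis
      by (auto simp: w_def d_def)
  qed
  have "(\<Sum>f\<in>F. w (z - f)) = 0" for z
  proof -
    obtain k g where z: "z = (k, g)"
      by force
    \<comment> \<open>Here the separate vanishing of every \<open>D n * P j\<close> is essential:
      \<open>conv\<close> alone would not survive the deletion of some slices.\<close>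
    have "Poly_Mapping.lookup (Abs_poly_mapping (\<lambda>x. w (n, x)) * P j) g = 0" if "j \<in> fst ` F" for n j
    proof -
      have "Poly_Mapping.lookup (Abs_poly_mapping (\<lambda>x. w (n, x)) * P j) g =
          of_bool (\<omega> n = 1) * Poly_Mapping.lookup (D n * P j) g"
        by (simp add: lookup_times_finite w_def D_def sum_distrib_left mult.assoc)
      then show ?thesis
        using DP[OF that] by simp
    qed
    then show ?thesis
      unfolding z sum_conv_slices[OF \<open>finite F\<close>] by (simp add: P_def)
  qed
  then have "direct_sum (mixed A \<omega>) F = Some S"
    unfolding direct_sum_eq_Some_iff[OF \<open>finite F\<close>] mixed by (simp add: sum.distrib S)
  with \<open>direct_sum (A 0) F = Some S\<close> show ?thesis
    by (simp add: defined_eq_def)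
qed

end
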